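(* Let $G$ be a connected graph of order $n\geq 4$ and size $m$, and let $K_{s,s}$, $s\geq 2$, be a maximal complete bipartite subgraph of $G$. Let $H=G\setminus K_{s,s}$ be obtained by deleting the edges of this $K_{s,s}$, and suppose $H$ has $r$ non-trivial components $C_1,\dots,C_r$, each of which is a $c$-cyclic graph, and $p\geq 0$ trivial components. Say Brouwer's conjecture holds for $k$ if $S_k(G)\le m+\frac{k(k+1)}{2}$. If $s\geq \frac{5+\sqrt{8r(c-1)+34}}{2}$, then Brouwer's conjecture holds for all $k\in\{1,\dots,n\}$. If $s< \frac{5+\sqrt{8r(c-1)+34}}{2}$, then Brouwer's conjecture holds for all integers $k\in [x_1,n]$ and all integers $k\in [1,y_1]$, where \[x_1=\frac{2s+3+\sqrt{20s-4s^2+8r(c-1)+9}}{2},\qquad y_1=\frac{2s+3-\sqrt{20s-4s^2+8r(c-1)+9}}{2}.\]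
   Context: The Laplacian matrix of a graph is $L(G)=D(G)-A(G)$ with eigenvalues $\mu_1\ge\dots\ge\mu_n=0$; $S_k(G)=\sum_{i=1}^k\mu_i$. A $c$-cyclic graph is a connected graph with $n'$ vertices and $n'+c-1$ edges. Trivial components are isolated vertices; non-trivial components have at least two vertices. *)

theory Defs
  imports
    "Jordan_Normal_Form.Char_Poly"
    "Graph_Theory.Graph_Theory"
begin

text \<open>
  Finite simple undirected graphs are the symmetric digraphs of the locale \<^locale>\<open>graph\<close>: an
  undirected edge is a pair of opposite arcs. The size therefore counts the two-element sets of
  end points, not the arcs.
\<close>

definition num_edges :: "('a, 'b) pre_digraph \<Rightarrow> nat" where
  "num_edges G = card ((\<lambda>e. {tail G e, head G e}) ` arcs G)"

definition delete_edges :: "('a, 'b) pre_digraph \<Rightarrow> ('a, 'b) pre_digraph \<Rightarrow> ('a, 'b) pre_digraph" where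
  "delete_edges G K = G\<lparr>arcs := arcs G - arcs K\<rparr>"

definition complete_bipartite :: "('a, 'b) pre_digraph \<Rightarrow> bool" where
  "complete_bipartite K \<longleftrightarrow> (\<exists>a b. a \<ge> 1 \<and> b \<ge> 1 \<and> complete_bipartite_digraph a b K)"

text \<open>In a symmetric digraph the strongly connected components are the connected components.\<close>

definition trivial_components :: "('a, 'b) pre_digraph \<Rightarrow> ('a, 'b) pre_digraph set" where
  "trivial_components G = {C \<in> pre_digraph.sccs G. card (verts C) = 1}"

definition nontrivial_components :: "('a, 'b) pre_digraph \<Rightarrow> ('a, 'b) pre_digraph set" where
  "nontrivial_components G = {C \<in> pre_digraph.sccs G. card (verts C) \<ge> 2}"

text \<open>The edge count is \<open>n' + c - 1\<close>, written without truncated subtraction; \<open>c = 0\<close> gives trees.\<close>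

definition cyclic_graph :: "nat \<Rightarrow> ('a, 'b) pre_digraph \<Rightarrow> bool" where
  "cyclic_graph c C \<longleftrightarrow>
     graph C \<and> Digraph_Component.connected C \<and> num_edges C + 1 = card (verts C) + c"

text \<open>
  Matrices are indexed by natural numbers, so the vertices are listed in some order. The
  characteristic polynomial, and hence the spectrum, does not depend on this order.
\<close>

definition vertex_list :: "('a, 'b) pre_digraph \<Rightarrow> 'a list" where
  "vertex_list G = (SOME vs. distinct vs \<and> set vs = verts G)"

definition adjacency_matrix :: "('a, 'b) pre_digraph \<Rightarrow> real mat" where
  "adjacency_matrix G = mat (card (verts G)) (card (verts G))
     (\<lambda>(i, j). if (vertex_list G ! i, vertex_list G ! j) \<in> arcs_ends G then 1 else 0)"

definition degree_matrix :: "('a, 'b) pre_digraph \<Rightarrow> real mat" where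
  "degree_matrix G = mat (card (verts G)) (card (verts G))
     (\<lambda>(i, j). if i = j then real (out_degree G (vertex_list G ! i)) else 0)"

definition laplacian_matrix :: "('a, 'b) pre_digraph \<Rightarrow> real mat" where
  "laplacian_matrix G = degree_matrix G - adjacency_matrix G"

text \<open>
  The eigenvalues in non-increasing order, repeated according to their multiplicity as roots of
  the characteristic polynomial (all of them are real, since the matrix is symmetric). The list
  index starts at 0, so \<open>\<mu>\<^sub>i\<close> is entry \<open>i - 1\<close>.
\<close>

definition laplacian_eigenvalues :: "('a, 'b) pre_digraph \<Rightarrow> real list" where
  "laplacian_eigenvalues G =
     rev (sorted_list_of_multiset (proots (char_poly (laplacian_matrix G))))"

definition laplacian_sum :: "('a, 'b) pre_digraph \<Rightarrow> nat \<Rightarrow> real" where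
  "laplacian_sum G k = (\<Sum>i = 1..k. laplacian_eigenvalues G ! (i - 1))"

definition brouwer_holds :: "('a, 'b) pre_digraph \<Rightarrow> nat \<Rightarrow> bool" where
  "brouwer_holds G k \<longleftrightarrow>
     laplacian_sum G k \<le> real (num_edges G) + real k * (real k + 1) / 2"

end

theory Submission
  imports Defs "Jordan_Normal_Form.Schur_Decomposition"
begin

text \<open>
  The sum of the \<open>k\<close> largest Laplacian eigenvalues is the total Dirichlet energy of \<open>k\<close> orthonormal
  eigenvectors, and this energy is additive over the edge-disjoint graphs \<open>K\<^sub>s\<^sub>,\<^sub>s\<close> and \<open>H\<close>. By
  Bessel's inequality, \<open>k\<close> orthonormal vectors have energy at most \<open>s (k + 1)\<close> on \<open>K\<^sub>s\<^sub>,\<^sub>s\<close>. On a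
  graph with \<open>e\<close> edges and \<open>N\<close> non-isolated vertices it is at most \<open>2e - N + 2k\<close>: this holds for a
  disjoint union of stars, and each further edge contributes at most 2. For \<open>H\<close> the components give
  \<open>e - N = r (c - 1)\<close>. Adding up, Brouwer's inequality follows whenever
  \<open>k\<^sup>2 - (2s + 3) k + 2s\<^sup>2 - 2s - 2r (c - 1) \<ge> 0\<close>, and \<open>x\<^sub>1\<close>, \<open>y\<^sub>1\<close> are the roots of this quadratic.
\<close>

section \<open>Orthonormal families\<close>

text \<open>The vectors are functions on the vertices, so that the energy estimates need no vertex
  order; only values on \<open>V\<close> matter.\<close>

definition orthonormal_on :: "'a set \<Rightarrow> nat \<Rightarrow> (nat \<Rightarrow> 'a \<Rightarrow> real) \<Rightarrow> bool" where
  "orthonormal_on V k v \<longleftrightarrow> (\<forall>i<k. \<forall>j<k. (\<Sum>a\<in>V. v i a * v j a) = of_bool (i = j))"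

text \<open>The residual of \<open>u\<close> after projection onto the family has nonnegative
  squared norm. Each energy bound below applies this to a test vector adapted to an edge, a star or
  \<open>K\<close>.\<close>

lemma bessel_inequality:
  assumes "orthonormal_on V k v"
  shows "(\<Sum>j<k. (\<Sum>a\<in>V. u a * v j a)\<^sup>2) \<le> (\<Sum>a\<in>V. (u a)\<^sup>2)"
proof -
  define c where "c j = (\<Sum>a\<in>V. u a * v j a)" for j
  have cross: "(\<Sum>a\<in>V. u a * (\<Sum>j<k. c j * v j a)) = (\<Sum>j<k. (c j)\<^sup>2)"
  proof -
    have "(\<Sum>a\<in>V. u a * (\<Sum>j<k. c j * v j a)) = (\<Sum>j<k. c j * (\<Sum>a\<in>V. u a * v j a))"
      by (simp add: sum_distrib_left sum.swap[of _ V] ac_simps)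
    then show ?thesis
      by (simp add: c_def power2_eq_square)
  qed
  have square: "(\<Sum>a\<in>V. (\<Sum>j<k. c j * v j a)\<^sup>2) = (\<Sum>j<k. (c j)\<^sup>2)"
  proof -
    have "(\<Sum>a\<in>V. (\<Sum>j<k. c j * v j a)\<^sup>2)
        = (\<Sum>a\<in>V. \<Sum>i<k. \<Sum>j<k. c i * c j * (v i a * v j a))"
      by (simp add: power2_eq_square sum_product ac_simps)
    also have "\<dots> = (\<Sum>i<k. \<Sum>j<k. c i * c j * (\<Sum>a\<in>V. v i a * v j a))"
      by (simp add: sum.swap[of _ V] sum_distrib_left)
    also have "\<dots> = (\<Sum>i<k. \<Sum>j<k. if i = j then c i * c j else 0)"
      using assms by (intro sum.cong refl) (auto simp: orthonormal_on_def)
    also have "\<dots> = (\<Sum>i<k. (c i)\<^sup>2)"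
      by (simp add: power2_eq_square)
    finally show ?thesis .
  qed
  have "0 \<le> (\<Sum>a\<in>V. (u a - (\<Sum>j<k. c j * v j a))\<^sup>2)"
    by (simp add: sum_nonneg)
  also have "\<dots> = (\<Sum>a\<in>V. (u a)\<^sup>2) - 2 * (\<Sum>a\<in>V. u a * (\<Sum>j<k. c j * v j a))
      + (\<Sum>a\<in>V. (\<Sum>j<k. c j * v j a)\<^sup>2)"
    by (simp add: power2_diff sum.distrib sum_subtractf sum_distrib_left ac_simps)
  finally show ?thesis
    unfolding cross square by (simp add: c_def)
qed

lemma sum_norm_orthonormal_on:
  assumes "orthonormal_on V k v"
  shows "(\<Sum>j<k. \<Sum>a\<in>V. (v j a)\<^sup>2) = real k"
  using assms by (simp add: orthonormal_on_def power2_eq_square)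

section \<open>Dirichlet energy of orthonormal families\<close>

text \<open>An undirected edge is counted once in each direction, hence the factor \<open>1/2\<close>.\<close>

definition energy :: "('a \<times> 'a) set \<Rightarrow> ('a \<Rightarrow> real) \<Rightarrow> real" where
  "energy R x = (\<Sum>(a, b)\<in>R. (x a - x b)\<^sup>2) / 2"

lemma energy_Un_disjoint:
  assumes "finite R" "finite S" "R \<inter> S = {}"
  shows "energy (R \<union> S) x = energy R x + energy S x"
  unfolding energy_def using assms by (simp add: sum.union_disjoint add_divide_distrib)

text \<open>A pair contributes the squared inner product with a difference of two indicator
  functions, of squared norm 2. The factor \<open>1/2\<close> in \<open>energy\<close> leaves 1 per
  ordered pair, hence 2 per undirected edge.\<close>

lemma sum_energy_le_card:
  assumes on: "orthonormal_on V k v" and "finite V" "R \<subseteq> V \<times> V" "irrefl R"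
  shows "(\<Sum>j<k. energy R (v j)) \<le> card R"
proof -
  have arc: "(\<Sum>j<k. (v j a - v j b)\<^sup>2) \<le> 2" if "(a, b) \<in> R" for a b
  proof -
    have "a \<noteq> b" "a \<in> V" "b \<in> V"
      using that assms by (auto simp: irrefl_def)
    define u :: "'a \<Rightarrow> real" where "u c = of_bool (c = a) - of_bool (c = b)" for c
    have ip: "(\<Sum>c\<in>V. u c * v j c) = v j a - v j b" for j
      using \<open>finite V\<close> \<open>a \<in> V\<close> \<open>b \<in> V\<close>
      by (simp add: u_def left_diff_distrib sum_subtractf)
    have "(u c)\<^sup>2 = of_bool (c = a) + of_bool (c = b)" for c
      using \<open>a \<noteq> b\<close> by (auto simp: u_def)
    then have "(\<Sum>c\<in>V. (u c)\<^sup>2) = 2"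
      using \<open>finite V\<close> \<open>a \<in> V\<close> \<open>b \<in> V\<close>
      by (simp add: sum.distrib of_bool_def sum.delta)
    then show ?thesis
      using bessel_inequality[OF on, of u] by (simp add: ip)
  qed
  have "(\<Sum>j<k. energy R (v j)) = (\<Sum>(a, b)\<in>R. \<Sum>j<k. (v j a - v j b)\<^sup>2) / 2"
    by (simp add: energy_def sum_divide_distrib[symmetric] case_prod_beta sum.swap[of _ R])
  also have "\<dots> \<le> (\<Sum>(a, b)\<in>R. 2) / 2"
    using arc by (intro divide_right_mono sum_mono) auto
  finally show ?thesis
    by (simp add: case_prod_beta)
qed

text \<open>
  A star with \<open>t\<close> leaves has Laplacian eigenvalues \<open>t + 1\<close>, \<open>1\<close> and \<open>0\<close>, so that subtracting twice the
  identity leaves one positive eigenvalue \<open>t - 1\<close>. Its eigenvector is \<open>t\<close> at the centre and \<open>-1\<close> at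
  the leaves, of squared norm \<open>t (t + 1)\<close>.
\<close>

lemma star_energy_le:
  fixes x :: "'a \<Rightarrow> real"
  assumes "finite L" "card L = t" "t \<ge> 1"
  shows "(\<Sum>l\<in>L. (z - x l)\<^sup>2)
     \<le> 2 * z\<^sup>2 + 2 * (\<Sum>l\<in>L. (x l)\<^sup>2)
        + (real t - 1) / (real t * (real t + 1)) * (real t * z - (\<Sum>l\<in>L. x l))\<^sup>2"
proof -
  define S where "S = (\<Sum>l\<in>L. x l)"
  define Q where "Q = (\<Sum>l\<in>L. (x l)\<^sup>2)"
  have t: "real t \<ge> 1"
    using assms by simp
  \<comment> \<open>The variance of the leaf values yields Cauchy-Schwarz; it is the slack on the
    eigenspace of eigenvalue 1.\<close>
  have "0 \<le> (\<Sum>l\<in>L. (x l - S / real t)\<^sup>2)"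
    by (simp add: sum_nonneg)
  also have "\<dots> = Q - 2 * (S / real t) * S + real t * (S / real t)\<^sup>2"
    using assms
    by (simp add: power2_diff sum.distrib sum_subtractf S_def Q_def ac_simps
        flip: sum_distrib_left sum_distrib_right sum_divide_distrib)
  finally have SQ: "S\<^sup>2 / real t \<le> Q"
    using t by (simp add: power2_eq_square)
  have "(\<Sum>l\<in>L. (z - x l)\<^sup>2) = real t * z\<^sup>2 - 2 * z * S + Q"
    using assms by (simp add: power2_diff sum.distrib sum_subtractf sum_distrib_left S_def Q_def)
  \<comment> \<open>The remaining slack lies along the constant vector, of eigenvalue 0 and squared
    norm \<open>t + 1\<close>.\<close>
  moreover have "2 * z\<^sup>2 + S\<^sup>2 / real t
        + (real t - 1) / (real t * (real t + 1)) * (real t * z - S)\<^sup>2 - (real t * z\<^sup>2 - 2 * z * S)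
      = 2 * (S + z)\<^sup>2 / (real t + 1)"
    using t by (simp add: divide_simps) (simp add: power2_eq_square algebra_simps)
  moreover have "0 \<le> 2 * (S + z)\<^sup>2 / (real t + 1)"
    using t by simp
  ultimately show ?thesis
    unfolding S_def[symmetric] Q_def[symmetric] using SQ by linarith
qed

lemma card_eq_sum_card_Image:
  assumes "finite R"
  shows "card R = (\<Sum>a\<in>Domain R. card (R `` {a}))"
proof -
  have "R = (SIGMA a:Domain R. R `` {a})"
    by auto
  then have "card R = card (SIGMA a:Domain R. R `` {a})"
    by simp
  also have "\<dots> = (\<Sum>a\<in>Domain R. card (R `` {a}))"
    using assms by (intro card_SigmaI) (auto simp: finite_Domain finite_Image)
  finally show ?thesis .
qed

lemma sum_relation_restrict:
  assumes "finite R" "finite A"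
  shows "(\<Sum>(a, b)\<in>R \<inter> A \<times> UNIV. f a b) = (\<Sum>a\<in>A. \<Sum>b\<in>R `` {a}. f a b)"
proof -
  have "R \<inter> A \<times> UNIV = (SIGMA a:A. R `` {a})"
    by auto
  then show ?thesis
    using assms by (simp add: sum.Sigma finite_Image)
qed

lemma sum_converse: "(\<Sum>(a, b)\<in>R\<inverse>. f a b) = (\<Sum>(a, b)\<in>R. f b a)"
  by (rule sum.reindex_bij_witness[of _ prod.swap prod.swap]) auto

text \<open>Every edge has an end of degree 1, so the edges form disjoint stars. By
  \<open>star_energy_le\<close> each vertex is charged twice its squared value, in total at most
  \<open>2 * k\<close>; by Bessel the rank-one excess of the star at \<open>a\<close> adds at most
  \<open>t a - 1\<close> over the whole family.\<close>

lemma sum_energy_star_forest_le: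
  assumes on: "orthonormal_on V k v" and V: "finite V" "R \<subseteq> V \<times> V" and "irrefl R" "sym R"
    and leaf: "\<And>a b. (a, b) \<in> R \<Longrightarrow> card (R `` {a}) = 1 \<or> card (R `` {b}) = 1"
  shows "(\<Sum>j<k. energy R (v j)) \<le> 2 * real k + real (card R) - real (card (Domain R))"
proof -
  define t where "t a = card (R `` {a})" for a
  \<comment> \<open>\<open>Z\<close> are the centres of the stars with at least two leaves; both ends of an isolated edge lie in \<open>L\<close>.\<close>
  define Z where "Z = {a \<in> Domain R. t a \<noteq> 1}"
  define L where "L = {a \<in> Domain R. t a = 1}"
  define star where "star x a = (real (t a) - 1) / (real (t a) * (real (t a) + 1))
      * (real (t a) * x a - (\<Sum>b\<in>R `` {a}. x b))\<^sup>2" for x a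
  have finR: "finite R"
    using V by (meson finite_SigmaI finite_subset)
  have finD: "finite (Domain R)"
    by (simp add: finR finite_Domain)
  have finI: "finite (R `` {a})" for a
    by (simp add: finR finite_Image)
  have t1: "t a \<ge> 1" if "a \<in> Domain R" for a
    using that finI[of a] unfolding t_def
    by (metis DomainE Image_singleton_iff One_nat_def Suc_leI card_gt_0_iff empty_iff)
  have DomV: "Domain R \<subseteq> V"
    using V by auto
  have R_sym: "(b, a) \<in> R" if "(a, b) \<in> R" for a b
    using \<open>sym R\<close> that by (auto simp: sym_def)
  have ZL: "b \<in> L \<and> b \<notin> Z" if "(a, b) \<in> R" "a \<in> Z" for a b
    using that leaf[OF that(1)] R_sym[OF that(1)] by (auto simp: Z_def L_def t_def)
  have DomZL: "a \<in> Z \<or> a \<in> L" "b \<in> Z \<or> b \<in> L" if "(a, b) \<in> R" for a b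
    using that R_sym[OF that] by (auto simp: Z_def L_def)
  have ZL_disj: "Z \<inter> L = {}"
    by (auto simp: Z_def L_def)
  have finZL: "finite Z" "finite L"
    using finD by (auto simp: Z_def L_def)
  define RZ where "RZ = R \<inter> Z \<times> UNIV"
  define RL where "RL = R \<inter> L \<times> L"
  have fin: "finite RZ" "finite RL"
    using finR by (auto simp: RZ_def RL_def)
  \<comment> \<open>Pairs from a centre to a leaf, their reversals, and the isolated edges in both
    directions.\<close>
  have R_split: "R = RZ \<union> RZ\<inverse> \<union> RL"
    using R_sym DomZL by (auto simp: RZ_def RL_def)
  have disj: "RZ \<inter> RZ\<inverse> = {}" "(RZ \<union> RZ\<inverse>) \<inter> RL = {}"
    using ZL ZL_disj by (auto simp: RZ_def RL_def)
  have L_eq: "RZ\<inverse> \<union> RL = R \<inter> L \<times> UNIV"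
    using R_sym ZL ZL_disj DomZL unfolding RZ_def RL_def by blast
  have bound: "energy R x \<le> 2 * (\<Sum>a\<in>V. (x a)\<^sup>2) + (\<Sum>a\<in>Z. star x a)" for x
  proof -
    have "(\<Sum>(a, b)\<in>R. (x a - x b)\<^sup>2)
        = (\<Sum>(a, b)\<in>RZ. (x a - x b)\<^sup>2) + (\<Sum>(a, b)\<in>RZ\<inverse>. (x a - x b)\<^sup>2)
          + (\<Sum>(a, b)\<in>RL. (x a - x b)\<^sup>2)"
      using disj fin by (subst R_split) (simp add: sum.union_disjoint)
    then have split: "energy R x = (\<Sum>(a, b)\<in>RZ. (x a - x b)\<^sup>2) + (\<Sum>(a, b)\<in>RL. (x a - x b)\<^sup>2) / 2"
      by (simp add: energy_def sum_converse power2_commute)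
    have "(\<Sum>(a, b)\<in>RZ. (x a - x b)\<^sup>2) = (\<Sum>a\<in>Z. \<Sum>b\<in>R `` {a}. (x a - x b)\<^sup>2)"
      unfolding RZ_def using finR finZL(1) by (rule sum_relation_restrict)
    also have "\<dots> \<le> (\<Sum>a\<in>Z. 2 * (x a)\<^sup>2 + 2 * (\<Sum>b\<in>R `` {a}. (x b)\<^sup>2) + star x a)"
      unfolding star_def by (intro sum_mono star_energy_le finI t1) (auto simp: t_def Z_def)
    also have "\<dots> = 2 * (\<Sum>a\<in>Z. (x a)\<^sup>2) + 2 * (\<Sum>(a, b)\<in>RZ. (x b)\<^sup>2) + (\<Sum>a\<in>Z. star x a)"
      using sum_relation_restrict[OF finR finZL(1), of "\<lambda>a b. (x b)\<^sup>2"]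
      by (simp add: RZ_def sum.distrib sum_distrib_left)
    finally have Zpart: "(\<Sum>(a, b)\<in>RZ. (x a - x b)\<^sup>2) \<le> \<dots>" .
    \<comment> \<open>A single edge has eigenvalues 2 and 0; the slack is the square of
      \<open>x a + x b\<close>.\<close>
    have "(\<Sum>(a, b)\<in>RL. (x a - x b)\<^sup>2) \<le> (\<Sum>(a, b)\<in>RL. 2 * (x a)\<^sup>2 + 2 * (x b)\<^sup>2)"
    proof (rule sum_mono, clarsimp)
      fix a b
      have "0 \<le> (x a + x b)\<^sup>2" by simp
      then show "(x a - x b)\<^sup>2 \<le> 2 * (x a)\<^sup>2 + 2 * (x b)\<^sup>2"
        by (simp add: power2_eq_square algebra_simps)
    qed
    also have "\<dots> = 2 * (\<Sum>(a, b)\<in>RL. (x a)\<^sup>2) + 2 * (\<Sum>(a, b)\<in>RL\<inverse>. (x a)\<^sup>2)"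
      unfolding sum_converse by (simp add: sum.distrib sum_distrib_left case_prod_beta)
    also have "RL\<inverse> = RL"
      using R_sym by (auto simp: RL_def)
    finally have Lpart: "(\<Sum>(a, b)\<in>RL. (x a - x b)\<^sup>2) / 2 \<le> 2 * (\<Sum>(a, b)\<in>RL. (x a)\<^sup>2)"
      by simp
    \<comment> \<open>A vertex of \<open>L\<close> has degree 1, so it starts exactly one pair and
      its squared value is charged once.\<close>
    have "(\<Sum>(a, b)\<in>RZ. (x b)\<^sup>2) + (\<Sum>(a, b)\<in>RL. (x a)\<^sup>2)
        = (\<Sum>(a, b)\<in>RZ\<inverse>. (x a)\<^sup>2) + (\<Sum>(a, b)\<in>RL. (x a)\<^sup>2)"
      by (simp add: sum_converse)
    also have "\<dots> = (\<Sum>(a, b)\<in>RZ\<inverse> \<union> RL. (x a)\<^sup>2)"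
      using disj fin by (intro sum.union_disjoint[symmetric]) auto
    also have "\<dots> = (\<Sum>(a, b)\<in>R \<inter> L \<times> UNIV. (x a)\<^sup>2)"
      by (simp only: L_eq)
    also have "\<dots> = (\<Sum>a\<in>L. \<Sum>b\<in>R `` {a}. (x a)\<^sup>2)"
      using finR finZL by (intro sum_relation_restrict)
    also have "\<dots> = (\<Sum>a\<in>L. (x a)\<^sup>2)"
      by (intro sum.cong refl) (auto simp: L_def t_def)
    finally have Lmass: "(\<Sum>(a, b)\<in>RZ. (x b)\<^sup>2) + (\<Sum>(a, b)\<in>RL. (x a)\<^sup>2) = (\<Sum>a\<in>L. (x a)\<^sup>2)" .
    have "(\<Sum>a\<in>Z. (x a)\<^sup>2) + (\<Sum>a\<in>L. (x a)\<^sup>2) = (\<Sum>a\<in>Domain R. (x a)\<^sup>2)"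
      using finD by (subst sum.union_disjoint[symmetric]) (auto simp: Z_def L_def intro!: sum.cong)
    also have "\<dots> \<le> (\<Sum>a\<in>V. (x a)\<^sup>2)"
      using V DomV by (intro sum_mono2) auto
    finally show ?thesis
      using split Zpart Lpart Lmass by linarith
  qed
  have star_sum: "(\<Sum>j<k. star (v j) a) \<le> real (t a) - 1" if "a \<in> Domain R" for a
  proof -
    define u where "u c = real (t a) * of_bool (c = a) - of_bool (c \<in> R `` {a})" for c
    have aV: "a \<in> V" and LV: "R `` {a} \<subseteq> V" and ani: "a \<notin> R `` {a}"
      using that V \<open>irrefl R\<close> by (auto simp: irrefl_def)
    have restrict: "(\<Sum>c\<in>V. if c \<in> R `` {a} then f c else 0) = sum f (R `` {a})" for f :: "'a \<Rightarrow> real"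
      using LV V(1) by (intro sum.mono_neutral_cong_right) auto
    have ip: "(\<Sum>c\<in>V. u c * v j c) = real (t a) * v j a - (\<Sum>b\<in>R `` {a}. v j b)" for j
    proof -
      have "(\<Sum>c\<in>V. u c * v j c) = (\<Sum>c\<in>V. (if c = a then real (t a) * v j c else 0)
          - (if c \<in> R `` {a} then v j c else 0))"
        by (intro sum.cong refl) (auto simp: u_def left_diff_distrib)
      also have "\<dots> = (\<Sum>c\<in>V. if c = a then real (t a) * v j c else 0)
          - (\<Sum>c\<in>V. if c \<in> R `` {a} then v j c else 0)"
        by (rule sum_subtractf)
      finally show ?thesis
        unfolding restrict using V aV by simp
    qed
    have "(\<Sum>c\<in>V. (u c)\<^sup>2)
        = (\<Sum>c\<in>V. (if c = a then (real (t a))\<^sup>2 else 0) + (if c \<in> R `` {a} then 1 else 0))"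
      using ani by (intro sum.cong refl) (auto simp: u_def)
    also have "\<dots> = (\<Sum>c\<in>V. if c = a then (real (t a))\<^sup>2 else 0)
        + (\<Sum>c\<in>V. if c \<in> R `` {a} then 1 else 0)"
      by (rule sum.distrib)
    also have "\<dots> = real (t a) * (real (t a) + 1)"
      unfolding restrict using V aV by (simp add: t_def power2_eq_square algebra_simps)
    finally have norm: "(\<Sum>c\<in>V. (u c)\<^sup>2) = real (t a) * (real (t a) + 1)" .
    have "(\<Sum>j<k. star (v j) a) = (real (t a) - 1) / (real (t a) * (real (t a) + 1))
        * (\<Sum>j<k. (\<Sum>c\<in>V. u c * v j c)\<^sup>2)"
      by (simp add: star_def ip sum_distrib_left)
    also have "\<dots> \<le> (real (t a) - 1) / (real (t a) * (real (t a) + 1))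
        * (real (t a) * (real (t a) + 1))"
      using bessel_inequality[OF on, of u] t1[OF that] by (intro mult_left_mono) (auto simp: norm)
    also have "\<dots> = real (t a) - 1"
      using t1[OF that] by simp
    finally show ?thesis .
  qed
  have "(\<Sum>j<k. energy R (v j)) \<le> (\<Sum>j<k. 2 * (\<Sum>a\<in>V. (v j a)\<^sup>2) + (\<Sum>a\<in>Z. star (v j) a))"
    by (intro sum_mono bound)
  also have "\<dots> = 2 * real k + (\<Sum>a\<in>Z. \<Sum>j<k. star (v j) a)"
    by (simp add: sum.distrib sum_distrib_left[symmetric] sum_norm_orthonormal_on[OF on] sum.swap[of _ Z])
  also have "(\<Sum>a\<in>Z. \<Sum>j<k. star (v j) a) \<le> (\<Sum>a\<in>Z. real (t a) - 1)"
    by (intro sum_mono star_sum) (auto simp: Z_def)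
  \<comment> \<open>Vertices of \<open>L\<close> have \<open>t a - 1 = 0\<close>, so the sum may run
    over all non-isolated vertices.\<close>
  also have "\<dots> = (\<Sum>a\<in>Domain R. real (t a) - 1)"
    using finD by (intro sum.mono_neutral_left) (auto simp: Z_def)
  also have "\<dots> = real (card R) - real (card (Domain R))"
    using card_eq_sum_card_Image[OF finR] by (simp add: sum_subtractf t_def)
  finally show ?thesis
    by simp
qed

text \<open>
  Deleting an edge whose end points both have degree at least 2 lowers the right-hand side by exactly 2,
  the most that an edge can contribute. When no such edge is left, every component is a star.
\<close>

lemma sum_energy_le:
  assumes on: "orthonormal_on V k v" and V: "finite V" "R \<subseteq> V \<times> V" and "irrefl R" "sym R"
  shows "(\<Sum>j<k. energy R (v j)) \<le> 2 * real k + real (card R) - real (card (Domain R))"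
  using assms(3-)
proof (induction "card R" arbitrary: R rule: less_induct)
  case less
  note RV = less.prems
  have finR: "finite R"
    using V RV by (meson finite_SigmaI finite_subset)
  show ?case
  proof (cases "\<forall>(a, b)\<in>R. card (R `` {a}) = 1 \<or> card (R `` {b}) = 1")
    case True
    then show ?thesis
      using sum_energy_star_forest_le[OF on V(1) RV] by blast
  next
    case False
    then obtain a b where ab: "(a, b) \<in> R" "card (R `` {a}) \<noteq> 1" "card (R `` {b}) \<noteq> 1"
      by blast
    define E where "E = {(a, b), (b, a)}"
    define R0 where "R0 = R - E"
    have "a \<noteq> b"
      using ab RV by (auto simp: irrefl_def)
    have ba: "(b, a) \<in> R"
      using ab RV by (auto dest: symD)
    have ER: "E \<subseteq> R" "card E = 2" "finite E"
      using ab ba \<open>a \<noteq> b\<close> by (auto simp: E_def)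
    \<comment> \<open>Both ends of the deleted edge keep another neighbour, so no vertex becomes
      isolated and \<open>Domain R\<close> is unchanged.\<close>
    have other: "\<exists>c. c \<noteq> y \<and> (x, c) \<in> R" if "(x, y) \<in> R" "card (R `` {x}) \<noteq> 1" for x y
    proof (rule ccontr)
      assume "\<not> ?thesis"
      with that have "R `` {x} = {y}"
        by auto
      with that show False
        by simp
    qed
    have "Domain R0 = Domain R"
    proof
      show "Domain R \<subseteq> Domain R0"
      proof
        fix x assume "x \<in> Domain R"
        then obtain y where y: "(x, y) \<in> R" by auto
        show "x \<in> Domain R0"
        proof (cases "(x, y) \<in> E")
          case True
          then obtain c where "c \<noteq> y" "(x, c) \<in> R"
            using other[OF y] ab by (auto simp: E_def)
          then show ?thesis
            using True \<open>a \<noteq> b\<close> by (auto simp: R0_def E_def)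
        qed (use y in \<open>auto simp: R0_def\<close>)
      qed
    qed (auto simp: R0_def)
    have card: "card R = card R0 + 2"
      using ER finR by (metis R0_def add.commute card_Diff_subset card_mono le_add_diff_inverse)
    have prems: "R0 \<subseteq> V \<times> V" "irrefl R0" "sym R0" "E \<subseteq> V \<times> V" "irrefl E"
      using RV ER \<open>a \<noteq> b\<close> by (auto simp: R0_def E_def irrefl_def sym_def)
    have "energy R x = energy R0 x + energy E x" for x
      using energy_Un_disjoint[of R0 E x] ER finR by (auto simp: R0_def Un_absorb2)
    then have "(\<Sum>j<k. energy R (v j)) = (\<Sum>j<k. energy R0 (v j)) + (\<Sum>j<k. energy E (v j))"
      by (simp add: sum.distrib)
    moreover have "(\<Sum>j<k. energy E (v j)) \<le> 2"
      using sum_energy_le_card[OF on V(1) prems(4,5)] ER by simp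
    moreover have "(\<Sum>j<k. energy R0 (v j)) \<le> 2 * real k + real (card R0) - real (card (Domain R0))"
      by (rule less.hyps) (use card prems in auto)
    ultimately show ?thesis
      using card \<open>Domain R0 = Domain R\<close> by simp
  qed
qed

text \<open>The Laplacian eigenvalues of the bipartite graph are \<open>2 * s\<close>,
  \<open>s\<close> and 0. Subtracting \<open>s\<close> times the identity leaves one positive
  eigenvalue \<open>s\<close>, with eigenvector 1 on \<open>U\<close> and -1 on \<open>W\<close>; by
  Bessel it adds only \<open>s\<close> for the whole family.\<close>

lemma sum_energy_complete_bipartite_le:
  assumes on: "orthonormal_on V k v" and "finite V" "U \<subseteq> V" "W \<subseteq> V" "U \<inter> W = {}"
    and "card U = s" "card W = s"
  shows "(\<Sum>j<k. energy (U \<times> W \<union> W \<times> U) (v j)) \<le> real s * (real k + 1)"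
proof -
  have fin: "finite U" "finite W"
    using assms finite_subset by auto
  have bound: "energy (U \<times> W \<union> W \<times> U) x
      \<le> real s * (\<Sum>a\<in>V. (x a)\<^sup>2) + (\<Sum>a\<in>V. (of_bool (a \<in> U) - of_bool (a \<in> W)) * x a)\<^sup>2 / 2" for x
  proof -
    have "W \<times> U = (U \<times> W)\<inverse>"
      by auto
    then have "(\<Sum>(a, b)\<in>W \<times> U. (x a - x b)\<^sup>2) = (\<Sum>(a, b)\<in>U \<times> W. (x a - x b)\<^sup>2)"
      by (simp only: sum_converse power2_commute)
    then have "energy (U \<times> W \<union> W \<times> U) x = (\<Sum>(a, b)\<in>U \<times> W. (x a - x b)\<^sup>2)"
      unfolding energy_def using fin assms by (subst sum.union_disjoint) auto
    also have "\<dots> = (\<Sum>a\<in>U. \<Sum>b\<in>W. (x a - x b)\<^sup>2)"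
      by (simp add: sum.cartesian_product)
    also have "\<dots> = real s * ((\<Sum>a\<in>U. (x a)\<^sup>2) + (\<Sum>a\<in>W. (x a)\<^sup>2)) - 2 * (\<Sum>a\<in>U. x a) * (\<Sum>a\<in>W. x a)"
      using assms
      by (simp add: power2_diff sum.distrib sum_subtractf sum_distrib_left sum_distrib_right sum_product algebra_simps)
    \<comment> \<open>The discarded term is half the squared sum over \<open>U\<close> and
      \<open>W\<close> together, the direction of eigenvalue 0.\<close>
    also have "\<dots> \<le> real s * ((\<Sum>a\<in>U. (x a)\<^sup>2) + (\<Sum>a\<in>W. (x a)\<^sup>2)) + ((\<Sum>a\<in>U. x a) - (\<Sum>a\<in>W. x a))\<^sup>2 / 2"
      using zero_le_power2[of "(\<Sum>a\<in>U. x a) + (\<Sum>a\<in>W. x a)"] by (simp add: power2_eq_square field_simps)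
    also have "(\<Sum>a\<in>U. (x a)\<^sup>2) + (\<Sum>a\<in>W. (x a)\<^sup>2) \<le> (\<Sum>a\<in>V. (x a)\<^sup>2)"
      using assms fin by (subst sum.union_disjoint[symmetric]) (auto intro!: sum_mono2)
    also have "(\<Sum>a\<in>U. x a) - (\<Sum>a\<in>W. x a) = (\<Sum>a\<in>V. (of_bool (a \<in> U) - of_bool (a \<in> W)) * x a)"
      using assms fin
      by (simp add: left_diff_distrib sum_subtractf sum.inter_restrict[symmetric] Int_absorb1
          of_bool_def if_distrib[of "\<lambda>y. y * _"] cong: if_cong)
    finally show ?thesis
      by (simp add: mult_left_mono)
  qed
  have "(\<Sum>a\<in>V. (of_bool (a \<in> U) - of_bool (a \<in> W))\<^sup>2) = (\<Sum>a\<in>U \<union> W. 1::real)"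
    using assms by (intro sum.mono_neutral_cong_right) auto
  also have "\<dots> = 2 * real s"
    using assms fin by (simp add: card_Un_disjoint)
  finally have norm: "(\<Sum>a\<in>V. (of_bool (a \<in> U) - of_bool (a \<in> W))\<^sup>2) = 2 * real s" .
  have "(\<Sum>j<k. energy (U \<times> W \<union> W \<times> U) (v j))
      \<le> (\<Sum>j<k. real s * (\<Sum>a\<in>V. (v j a)\<^sup>2) + (\<Sum>a\<in>V. (of_bool (a \<in> U) - of_bool (a \<in> W)) * v j a)\<^sup>2 / 2)"
    by (intro sum_mono bound)
  also have "\<dots> = real s * real k
      + (\<Sum>j<k. (\<Sum>a\<in>V. (of_bool (a \<in> U) - of_bool (a \<in> W)) * v j a)\<^sup>2) / 2"
    by (simp add: sum.distrib sum_distrib_left[symmetric] sum_norm_orthonormal_on[OF on] sum_divide_distrib)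
  also have "\<dots> \<le> real s * real k + real s"
    using bessel_inequality[OF on, of "\<lambda>a. of_bool (a \<in> U) - of_bool (a \<in> W)"] norm by simp
  finally show ?thesis
    by (simp add: algebra_simps)
qed

section \<open>Eigenvalues of real symmetric matrices\<close>

text \<open>Over the complex numbers the polynomial splits. Moving the symmetric \<open>C\<close>
  across the Hermitian product of an eigenvector with itself gives \<open>a = cnj a\<close>, so the
  factors are real and the identity pulls back along the injective embedding.\<close>

lemma real_symmetric_char_poly_splits:
  fixes A :: "real mat"
  assumes A: "A \<in> carrier_mat n n" and symm: "transpose_mat A = A"
  shows "\<exists>es. char_poly A = (\<Prod>e\<leftarrow>es. [:- e, 1:]) \<and> length es = n"
proof -
  define C where "C = map_mat complex_of_real A"
  have C: "C \<in> carrier_mat n n"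
    using A by (simp add: C_def)
  have symmC: "transpose_mat C = C"
    using symm by (simp add: C_def map_mat_transpose)
  obtain as where as: "char_poly C = (\<Prod>a\<leftarrow>as. [:- a, 1:])" "length as = n"
    using char_poly_factorized[OF C] by blast
  have real: "a = complex_of_real (Re a)" if "a \<in> set as" for a
  proof -
    have "poly (char_poly C) a = 0"
      using that by (auto simp: as poly_prod_list prod_list_zero_iff)
    then obtain v where v: "v \<in> carrier_vec n" "v \<noteq> 0\<^sub>v n" "C *\<^sub>v v = a \<cdot>\<^sub>v v"
      using C by (auto simp: eigenvalue_root_char_poly[OF C, symmetric] eigenvalue_def eigenvector_def)
    \<comment> \<open>The entries of \<open>C\<close> are real, so conjugation passes through the
      product.\<close>
    have cC: "conjugate (C *\<^sub>v v) = C *\<^sub>v conjugate v"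
      using A v(1) by (intro eq_vecI) (auto simp: C_def scalar_prod_def)
    have cv: "conjugate v \<in> carrier_vec n"
      using v by simp
    have "a * (v \<bullet>c v) = (C *\<^sub>v v) \<bullet>c v"
      using v by simp
    also have "\<dots> = v \<bullet> (C *\<^sub>v conjugate v)"
      using transpose_vec_mult_scalar[OF C cv v(1)] symmC v(1) cv C
      by (metis comm_scalar_prod mult_mat_vec_carrier)
    also have "\<dots> = v \<bullet>c (a \<cdot>\<^sub>v v)"
      using cC v by simp
    also have "\<dots> = cnj a * (v \<bullet>c v)"
      using v by (simp add: conjugate_smult_vec)
    finally have "a = cnj a"
      using v by simp
    then show ?thesis
      by (simp add: complex_eq_iff)
  qed
  interpret of_real_poly: map_poly_inj_idom_hom complex_of_real ..
  define es where "es = map Re as"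
  have "map_poly complex_of_real (char_poly A) = char_poly C"
    unfolding C_def by (rule of_real_hom.char_poly_hom[OF A, symmetric])
  also have "\<dots> = (\<Prod>a\<leftarrow>map (\<lambda>a. complex_of_real (Re a)) as. [:- a, 1:])"
    using real as(1) by (metis (no_types, lifting) map_idI)
  also have "\<dots> = map_poly complex_of_real (\<Prod>e\<leftarrow>es. [:- e, 1:])"
    by (simp add: es_def of_real_poly.hom_prod_list o_def)
  finally have "char_poly A = (\<Prod>e\<leftarrow>es. [:- e, 1:])"
    by simp
  then show ?thesis
    using as(2) by (intro exI[of _ es]) (simp add: es_def)
qed


section \<open>Flags of spans and Gram-Schmidt orthonormalization\<close>

definition span_upto :: "'a set \<Rightarrow> (nat \<Rightarrow> 'a \<Rightarrow> real) \<Rightarrow> nat \<Rightarrow> ('a \<Rightarrow> real) set" where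
  "span_upto V u k = {x. \<exists>c. \<forall>a\<in>V. x a = (\<Sum>l<k. c l * u l a)}"

lemma span_uptoI:
  assumes "\<And>a. a \<in> V \<Longrightarrow> x a = (\<Sum>l<k. c l * u l a)"
  shows "x \<in> span_upto V u k"
  using assms unfolding span_upto_def by blast

lemma span_upto_add:
  assumes "x \<in> span_upto V u k" "y \<in> span_upto V u k"
  shows "(\<lambda>a. x a + y a) \<in> span_upto V u k"
proof -
  obtain c d where "\<forall>a\<in>V. x a = (\<Sum>l<k. c l * u l a)" "\<forall>a\<in>V. y a = (\<Sum>l<k. d l * u l a)"
    using assms by (auto simp: span_upto_def)
  then show ?thesis
    by (intro span_uptoI[where c = "\<lambda>l. c l + d l"]) (simp add: sum.distrib distrib_right)
qed

lemma span_upto_scale: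
  assumes "x \<in> span_upto V u k"
  shows "(\<lambda>a. r * x a) \<in> span_upto V u k"
proof -
  obtain c where "\<forall>a\<in>V. x a = (\<Sum>l<k. c l * u l a)"
    using assms by (auto simp: span_upto_def)
  then show ?thesis
    by (intro span_uptoI[where c = "\<lambda>l. r * c l"]) (simp add: sum_distrib_left mult.assoc)
qed

lemma span_upto_zero: "(\<lambda>a. 0) \<in> span_upto V u k"
  unfolding span_upto_def by (auto intro: exI[of _ "\<lambda>_. 0"])

lemma span_upto_sum:
  assumes "\<And>i. i \<in> I \<Longrightarrow> f i \<in> span_upto V u k"
  shows "(\<lambda>a. \<Sum>i\<in>I. f i a) \<in> span_upto V u k"
  using assms
  by (induction I rule: infinite_finite_induct) (auto intro: span_upto_add span_upto_zero)

lemma span_upto_mono: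
  assumes "k \<le> m"
  shows "span_upto V u k \<subseteq> span_upto V u m"
proof
  fix x assume "x \<in> span_upto V u k"
  then obtain c where c: "\<forall>a\<in>V. x a = (\<Sum>l<k. c l * u l a)"
    by (auto simp: span_upto_def)
  have "(\<Sum>l<k. c l * u l a) = (\<Sum>l<m. (if l < k then c l else 0) * u l a)" for a
    using assms by (intro sum.mono_neutral_cong_left) auto
  with c show "x \<in> span_upto V u m"
    by (intro span_uptoI[where c = "\<lambda>l. if l < k then c l else 0"]) auto
qed

lemma span_upto_base: "u k \<in> span_upto V u (Suc k)"
  by (rule span_uptoI[where c = "\<lambda>l. of_bool (l = k)"]) simp

lemma span_upto_cong:
  assumes "x \<in> span_upto V u k" "\<And>a. a \<in> V \<Longrightarrow> y a = x a"
  shows "y \<in> span_upto V u k"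
  using assms by (auto simp: span_upto_def)

lemma span_upto_orthogonal:
  assumes "orthonormal_on V n u" "k < n" "x \<in> span_upto V u k"
  shows "(\<Sum>a\<in>V. u k a * x a) = 0"
proof -
  obtain c where "\<forall>a\<in>V. x a = (\<Sum>l<k. c l * u l a)"
    using assms by (auto simp: span_upto_def)
  then have "(\<Sum>a\<in>V. u k a * x a) = (\<Sum>l<k. c l * (\<Sum>a\<in>V. u k a * u l a))"
    by (simp add: sum_distrib_left sum.swap[of _ V] ac_simps)
  also have "\<dots> = 0"
    using assms by (intro sum.neutral) (auto simp: orthonormal_on_def)
  finally show ?thesis .
qed

text \<open>The dual family \<open>q\<close> replaces linear independence of \<open>p\<close>: it shows that no residual vanishes.\<close>

lemma gram_schmidt_of_dual:
  fixes p q :: "nat \<Rightarrow> 'a \<Rightarrow> real"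
  assumes dual: "\<And>i l. i < n \<Longrightarrow> l < n \<Longrightarrow> (\<Sum>a\<in>V. q i a * p l a) = of_bool (i = l)"
    and "m \<le> n"
  shows "\<exists>u. orthonormal_on V m u
    \<and> (\<forall>k<m. \<exists>c y. c \<noteq> 0 \<and> y \<in> span_upto V u k \<and> (\<forall>a\<in>V. p k a = c * u k a + y a))
    \<and> (\<forall>k<m. \<forall>i<n. k < i \<longrightarrow> (\<Sum>a\<in>V. q i a * u k a) = 0)"
  using \<open>m \<le> n\<close>
proof (induction m)
  case 0
  then show ?case
    by (simp add: orthonormal_on_def)
next
  case (Suc m)
  then obtain u where on: "orthonormal_on V m u"
    and p: "\<forall>k<m. \<exists>c y. c \<noteq> 0 \<and> y \<in> span_upto V u k \<and> (\<forall>a\<in>V. p k a = c * u k a + y a)"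
    and q: "\<forall>k<m. \<forall>i<n. k < i \<longrightarrow> (\<Sum>a\<in>V. q i a * u k a) = 0"
    by auto
  define d where "d l = (\<Sum>a\<in>V. p m a * u l a)" for l
  define y where "y a = (\<Sum>l<m. d l * u l a)" for a
  define w where "w a = p m a - y a" for a
  define N where "N = (\<Sum>a\<in>V. (w a)\<^sup>2)"
  have ip_y: "(\<Sum>a\<in>V. f a * y a) = (\<Sum>l<m. d l * (\<Sum>a\<in>V. f a * u l a))" for f
    by (simp add: y_def sum_distrib_left sum.swap[of _ V] ac_simps)
  have wu: "(\<Sum>a\<in>V. u k a * w a) = 0" if "k < m" for k
  proof -
    have "(\<Sum>l<m. d l * (\<Sum>a\<in>V. u k a * u l a)) = (\<Sum>l<m. if l = k then d l else 0)"
      using on that by (intro sum.cong) (auto simp: orthonormal_on_def)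
    then show ?thesis
      using that by (simp add: w_def right_diff_distrib sum_subtractf ip_y) (simp add: d_def mult.commute)
  qed
  \<comment> \<open>\<open>q i\<close> annihilates the earlier \<open>u l\<close>, so subtracting
    the projection preserves its pairing with \<open>p m\<close>. For \<open>i = m\<close> the
    pairing is 1, hence \<open>w\<close> does not vanish on \<open>V\<close>.\<close>
  have qw: "(\<Sum>a\<in>V. q i a * w a) = of_bool (i = m)" if "m \<le> i" "i < n" for i
  proof -
    have "(\<Sum>l<m. d l * (\<Sum>a\<in>V. q i a * u l a)) = 0"
      using q that by (intro sum.neutral) auto
    then show ?thesis
      using dual[of i m] that by (simp add: w_def right_diff_distrib sum_subtractf ip_y)
  qed
  have "N \<noteq> 0"
  proof
    assume "N = 0"
    have "w a = 0" if "a \<in> V" for a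
    \<comment> \<open>Over an infinite \<open>V\<close> every sum defaults to 0, which contradicts
      the pairing 1.\<close>
    proof (cases "finite V")
      case True
      then show ?thesis
        using \<open>N = 0\<close> that by (simp add: N_def sum_nonneg_eq_0_iff)
    next
      case False
      then show ?thesis
        using qw[of m] Suc.prems by simp
    qed
    then show False
      using qw[of m] Suc.prems by simp
  qed
  moreover have "N \<ge> 0"
    by (simp add: N_def sum_nonneg)
  ultimately have "N > 0"
    by simp
  define u' where "u' = u(m := \<lambda>a. w a / sqrt N)"
  have u'_less: "u' k = u k" if "k < m" for k
    using that by (simp add: u'_def)
  have u'_m: "u' m = (\<lambda>a. w a / sqrt N)"
    by (simp add: u'_def)
  have span_eq: "span_upto V u' k = span_upto V u k" if "k \<le> m" for k
    using that u'_less by (simp add: span_upto_def)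
  have y_span: "y \<in> span_upto V u m"
    unfolding y_def by (rule span_uptoI) simp
  have mm: "(\<Sum>a\<in>V. u' m a * u' m a) = 1"
  proof -
    have "(\<Sum>a\<in>V. u' m a * u' m a) = N / (sqrt N * sqrt N)"
      by (simp add: u'_m N_def power2_eq_square sum_divide_distrib)
    then show ?thesis
      using \<open>N > 0\<close> by simp
  qed
  have mk: "(\<Sum>a\<in>V. u' k a * u' m a) = 0" if "k < m" for k
    using wu[OF that] by (simp add: u'_m u'_less[OF that] flip: sum_divide_distrib)
  have "orthonormal_on V (Suc m) u'"
    unfolding orthonormal_on_def
  proof (intro allI impI)
    fix i j assume "i < Suc m" "j < Suc m"
    then consider "i < m" "j < m" | "i < m" "j = m" | "i = m" "j < m" | "i = m" "j = m"
      by linarith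
    then show "(\<Sum>a\<in>V. u' i a * u' j a) = of_bool (i = j)"
    proof cases
      case 1
      then show ?thesis
        using on by (simp add: orthonormal_on_def u'_less)
    next
      case 3
      then show ?thesis
        using mk[of j] by (simp add: mult.commute)
    qed (use mk mm in auto)
  qed
  moreover have "\<exists>c y. c \<noteq> 0 \<and> y \<in> span_upto V u' k \<and> (\<forall>a\<in>V. p k a = c * u' k a + y a)"
    if "k < Suc m" for k
  proof (cases "k = m")
    case True
    have "\<forall>a\<in>V. p m a = sqrt N * u' m a + y a"
      using \<open>N > 0\<close> by (simp add: u'_m w_def)
    then show ?thesis
      using True \<open>N > 0\<close> y_span span_eq[of m]
      by (intro exI[of _ "sqrt N"] exI[of _ y]) auto
  next
    case False
    then show ?thesis
      using p that by (auto simp: u'_less span_eq)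
  qed
  moreover have "(\<Sum>a\<in>V. q i a * u' k a) = 0" if "k < Suc m" "i < n" "k < i" for k i
  proof (cases "k = m")
    case True
    then show ?thesis
      using qw[of i] that by (simp add: u'_m flip: sum_divide_distrib)
  next
    case False
    then show ?thesis
      using q that by (simp add: u'_less)
  qed
  ultimately show ?case
    by blast
qed

text \<open>
  The Schur decomposition of the library is not stated to be orthogonal. Orthonormalizing its basis keeps
  the flag of invariant subspaces, and with it the diagonal of the triangular matrix.
\<close>

lemma schur_orthonormal_diagonal:
  fixes A :: "real mat"
  assumes A: "A \<in> carrier_mat n n" and es: "char_poly A = (\<Prod>e\<leftarrow>es. [:- e, 1:])"
  shows "\<exists>u. orthonormal_on {..<n} n u
    \<and> (\<forall>k<n. es ! k = (\<Sum>a<n. u k a * (\<Sum>b<n. A $$ (a, b) * u k b)))"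
proof -
  obtain B P Q where "schur_decomposition A es = (B, P, Q)"
    by (cases "schur_decomposition A es")
  from schur_decomposition[OF A es this]
  have wit: "similar_mat_wit A B P Q" and ut: "upper_triangular B" and diag: "diag_mat B = es"
    by auto
  from similar_mat_witD2[OF A wit]
  have QP: "Q * P = 1\<^sub>m n" and APBQ: "A = P * B * Q" and B: "B \<in> carrier_mat n n"
    and P: "P \<in> carrier_mat n n" and Q: "Q \<in> carrier_mat n n"
    by auto
  \<comment> \<open>The columns of \<open>P\<close> are the Schur basis; since \<open>Q * P\<close>
    is the identity, the rows of \<open>Q\<close> are the dual family.\<close>
  define p where "p l a = P $$ (a, l)" for l a
  define q where "q i a = Q $$ (i, a)" for i a
  define T where "T x a = (\<Sum>b<n. A $$ (a, b) * x b)" for x :: "nat \<Rightarrow> real" and a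
  have dual: "(\<Sum>a<n. q i a * p l a) = of_bool (i = l)" if "i < n" "l < n" for i l
  proof -
    have "(Q * P) $$ (i, l) = (\<Sum>a<n. q i a * p l a)"
      using P Q that by (simp add: scalar_prod_def p_def q_def lessThan_atLeast0)
    moreover have "(Q * P) $$ (i, l) = of_bool (i = l)"
      using that by (simp add: QP)
    ultimately show ?thesis
      by simp
  qed
  have "A * P = P * B * (Q * P)"
    unfolding APBQ using P Q B by (simp add: assoc_mult_mat[of _ n n _ n _ n])
  then have AP: "A * P = P * B"
    using P B by (simp add: QP)
  \<comment> \<open>This is column \<open>k\<close> of \<open>A * P = P * B\<close>, cut off at the
    diagonal by triangularity.\<close>
  have Tp: "T (p k) a = B $$ (k, k) * p k a + (\<Sum>i<k. B $$ (i, k) * p i a)" if "k < n" "a < n" for k a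
  proof -
    have "T (p k) a = (A * P) $$ (a, k)"
      using A P that by (simp add: T_def p_def scalar_prod_def lessThan_atLeast0)
    also have "\<dots> = (\<Sum>i<n. P $$ (a, i) * B $$ (i, k))"
      unfolding AP using B P that by (simp add: scalar_prod_def lessThan_atLeast0)
    also have "\<dots> = (\<Sum>i<Suc k. P $$ (a, i) * B $$ (i, k))"
      using ut B that by (intro sum.mono_neutral_right) (auto simp: upper_triangular_def)
    finally show ?thesis
      by (simp add: p_def ac_simps)
  qed
  obtain u where on: "orthonormal_on {..<n} n u"
    and pu: "\<And>k. k < n \<Longrightarrow> \<exists>c y. c \<noteq> 0 \<and> y \<in> span_upto {..<n} u k \<and> (\<forall>a\<in>{..<n}. p k a = c * u k a + y a)"
    using gram_schmidt_of_dual[where V = "{..<n}" and q = q and p = p and n = n and m = n, OF dual] by auto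
  let ?S = "span_upto {..<n} u"
  have p_span: "p i \<in> ?S (Suc i)" if "i < n" for i
  proof -
    obtain c y where y: "y \<in> ?S i" "\<forall>a\<in>{..<n}. p i a = c * u i a + y a"
      using pu[OF \<open>i < n\<close>] by blast
    have "(\<lambda>a. c * u i a + y a) \<in> ?S (Suc i)"
      using y span_upto_mono[of i "Suc i"] by (intro span_upto_add span_upto_scale span_upto_base) auto
    then show ?thesis
      using y by (auto intro: span_upto_cong)
  qed
  \<comment> \<open>Modulo earlier vectors \<open>u k\<close> is a multiple of \<open>p k\<close>,
    and by induction \<open>T\<close> preserves the span of the earlier vectors, so the diagonal
    entry of \<open>B\<close> survives.\<close>
  have Tu: "\<exists>y\<in>?S k. \<forall>a<n. T (u k) a = B $$ (k, k) * u k a + y a" if "k < n" for k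
    using that
  proof (induction k rule: less_induct)
    case (less k)
    have T_span: "T x \<in> ?S k" if x: "x \<in> ?S k" for x
    proof -
      obtain c where c: "\<forall>a\<in>{..<n}. x a = (\<Sum>l<k. c l * u l a)"
        using x by (auto simp: span_upto_def)
      have T_eq: "T x a = (\<Sum>l<k. c l * T (u l) a)" for a
        using c by (simp add: T_def sum_distrib_left sum.swap[of _ "{..<n}"] ac_simps)
      have "T (u l) \<in> ?S k" if "l < k" for l
      proof -
        obtain y where y: "y \<in> ?S l" "\<forall>a<n. T (u l) a = B $$ (l, l) * u l a + y a"
          using less.IH[OF \<open>l < k\<close>] less.prems \<open>l < k\<close> by auto
        have "(\<lambda>a. B $$ (l, l) * u l a + y a) \<in> ?S (Suc l)"
          using y span_upto_mono[of l "Suc l"] by (intro span_upto_add span_upto_scale span_upto_base) auto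
        then have "T (u l) \<in> ?S (Suc l)"
          using y by (auto intro: span_upto_cong)
        then show ?thesis
          using span_upto_mono[of "Suc l" k] that by auto
      qed
      then have "(\<lambda>a. \<Sum>l<k. c l * T (u l) a) \<in> ?S k"
        by (intro span_upto_sum span_upto_scale) auto
      then show ?thesis
        by (rule span_upto_cong) (simp add: T_eq)
    qed
    obtain c y where c: "c \<noteq> 0" and y: "y \<in> ?S k" and pk: "\<forall>a\<in>{..<n}. p k a = c * u k a + y a"
      using pu[OF less.prems] by blast
    \<comment> \<open>Apply \<open>T\<close> to \<open>p k = c * u k + y\<close> and solve for
      \<open>T (u k)\<close>; \<open>z\<close> is what remains beside the diagonal term.\<close>
    define z where "z = (\<lambda>a. (1 / c) * ((B $$ (k, k) * y a + (\<Sum>i<k. B $$ (i, k) * p i a)) + (-1) * T y a))"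
    have "p i \<in> ?S k" if "i < k" for i
      using p_span[of i] less.prems that span_upto_mono[of "Suc i" k] by auto
    then have "z \<in> ?S k"
      unfolding z_def
      by (intro span_upto_scale span_upto_add span_upto_sum T_span y) auto
    moreover have "T (u k) a = B $$ (k, k) * u k a + z a" if "a < n" for a
    proof -
      have "T (p k) a = c * T (u k) a + T y a"
        using pk by (simp add: T_def sum_distrib_left sum.distrib algebra_simps)
      then show ?thesis
        using Tp[OF less.prems that] pk that c by (simp add: z_def field_simps)
    qed
    ultimately show ?case
      by blast
  qed
  \<comment> \<open>The remainder lies in the span of earlier vectors, hence is orthogonal to
    \<open>u k\<close>.\<close>
  have "es ! k = (\<Sum>a<n. u k a * T (u k) a)" if "k < n" for k
  proof -
    obtain y where y: "y \<in> ?S k" "\<forall>a<n. T (u k) a = B $$ (k, k) * u k a + y a"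
      using Tu[OF \<open>k < n\<close>] by blast
    have "(\<Sum>a<n. u k a * T (u k) a) = B $$ (k, k) * (\<Sum>a<n. u k a * u k a) + (\<Sum>a<n. u k a * y a)"
      using y by (simp add: sum_distrib_left sum.distrib algebra_simps)
    also have "\<dots> = B $$ (k, k)"
      using span_upto_orthogonal[OF on that y(1)] on that by (simp add: orthonormal_on_def)
    finally show ?thesis
      using diag B that by (auto simp: diag_mat_def)
  qed
  then show ?thesis
    using on unfolding T_def by blast
qed

section \<open>The Laplacian of a graph\<close>

text \<open>Expand the square: by symmetry the two sums of squares agree, and the factor
  \<open>1/2\<close> cancels the doubling. The bracket is the Laplacian entry at
  \<open>(a, b)\<close>.\<close>

lemma energy_eq_quadratic_form:
  assumes "finite V" "R \<subseteq> V \<times> V" "sym R"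
  shows "energy R y = (\<Sum>a\<in>V. y a * (\<Sum>b\<in>V. ((if a = b then real (card (R `` {a})) else 0)
      - (if (a, b) \<in> R then 1 else 0)) * y b))"
proof -
  have finR: "finite R"
    using assms by (meson finite_SigmaI finite_subset)
  have RV: "R \<inter> V \<times> UNIV = R"
    using assms by auto
  have "R\<inverse> = R"
    using assms by (auto simp: sym_def)
  then have "(\<Sum>(a, b)\<in>R. (y b)\<^sup>2) = (\<Sum>(a, b)\<in>R. (y a)\<^sup>2)"
    using sum_converse[of "\<lambda>a b. (y a)\<^sup>2" R] by simp
  then have "energy R y = (\<Sum>(a, b)\<in>R. (y a)\<^sup>2) - (\<Sum>(a, b)\<in>R. y a * y b)"
    by (simp add: energy_def case_prod_beta power2_diff sum.distrib sum_subtractf mult.assoc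
        flip: sum_distrib_left)
  also have "(\<Sum>(a, b)\<in>R. (y a)\<^sup>2) = (\<Sum>a\<in>V. real (card (R `` {a})) * (y a)\<^sup>2)"
    using sum_relation_restrict[OF finR \<open>finite V\<close>, of "\<lambda>a b. (y a)\<^sup>2"] by (simp add: RV)
  also have "(\<Sum>(a, b)\<in>R. y a * y b) = (\<Sum>a\<in>V. y a * (\<Sum>b\<in>V. if (a, b) \<in> R then y b else 0))"
  proof -
    have "(\<Sum>b\<in>R `` {a}. y b) = (\<Sum>b\<in>V. if (a, b) \<in> R then y b else 0)" for a
      using assms by (intro sum.mono_neutral_cong_left) auto
    then show ?thesis
      using sum_relation_restrict[OF finR \<open>finite V\<close>, of "\<lambda>a b. y a * y b"]
      by (simp add: RV flip: sum_distrib_left)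
  qed
  also have "(\<Sum>a\<in>V. real (card (R `` {a})) * (y a)\<^sup>2) - \<dots>
      = (\<Sum>a\<in>V. y a * ((\<Sum>b\<in>V. if a = b then real (card (R `` {a})) * y b else 0)
          - (\<Sum>b\<in>V. if (a, b) \<in> R then y b else 0)))"
    using \<open>finite V\<close>
    by (simp add: sum_subtractf right_diff_distrib power2_eq_square ac_simps)
  also have "\<dots> = (\<Sum>a\<in>V. y a * (\<Sum>b\<in>V. ((if a = b then real (card (R `` {a})) else 0)
      - (if (a, b) \<in> R then 1 else 0)) * y b))"
    by (intro sum.cong refl arg_cong[of _ _ "\<lambda>z. _ * z"])
      (auto simp: left_diff_distrib simp flip: sum_subtractf intro!: sum.cong)
  finally show ?thesis .
qed

text \<open>Energies run over ordered pairs, \<open>num_edges\<close> over sets of ends. Without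
  loops each fibre consists of a pair and its reversal.\<close>

lemma card_eq_twice_card_edges:
  assumes "finite R" "sym R" "irrefl R"
  shows "card R = 2 * card ((\<lambda>(a, b). {a, b}) ` R)"
proof -
  have "card R = (\<Sum>e\<in>(\<lambda>(a, b). {a, b}) ` R. card {p \<in> R. (case p of (a, b) \<Rightarrow> {a, b}) = e})"
    using sum.image_gen[OF assms(1), of "\<lambda>_. 1::nat" "\<lambda>(a, b). {a, b}"] by simp
  also have "\<dots> = (\<Sum>e\<in>(\<lambda>(a, b). {a, b}) ` R. 2)"
  proof (rule sum.cong[OF refl])
    fix e assume "e \<in> (\<lambda>(a, b). {a, b}) ` R"
    then obtain a b where ab: "(a, b) \<in> R" "e = {a, b}"
      by auto
    then have "(b, a) \<in> R" "a \<noteq> b"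
      using assms by (auto simp: sym_def irrefl_def)
    with ab have "{p \<in> R. (case p of (a, b) \<Rightarrow> {a, b}) = e} = {(a, b), (b, a)}"
      by (auto simp: doubleton_eq_iff)
    then show "card {p \<in> R. (case p of (a, b) \<Rightarrow> {a, b}) = e} = 2"
      using \<open>a \<noteq> b\<close> by simp
  qed
  finally show ?thesis
    by simp
qed

lemma graph_arcs_ends:
  assumes "graph G"
  shows "finite (arcs_ends G)" "arcs_ends G \<subseteq> verts G \<times> verts G" "sym (arcs_ends G)" "irrefl (arcs_ends G)"
proof -
  interpret graph G by fact
  show "finite (arcs_ends G)"
    by (simp add: arcs_ends_def)
  show "arcs_ends G \<subseteq> verts G \<times> verts G"
    by (auto simp: arcs_ends_conv)
  show "sym (arcs_ends G)"
    using sym_arcs by (simp add: symmetric_def)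
  show "irrefl (arcs_ends G)"
    using no_loops by (auto simp: arcs_ends_conv irrefl_def)
qed

lemma card_arcs_ends:
  assumes "graph G"
  shows "card (arcs_ends G) = 2 * num_edges G"
proof -
  have "(\<lambda>(a, b). {a, b}) ` arcs_ends G = (\<lambda>e. {tail G e, head G e}) ` arcs G"
    by (simp add: arcs_ends_conv image_image)
  then show ?thesis
    using card_eq_twice_card_edges[of "arcs_ends G"] graph_arcs_ends[OF assms]
    by (simp add: num_edges_def)
qed

lemma out_degree_eq_card_Image:
  assumes "graph G"
  shows "out_degree G a = card (arcs_ends G `` {a})"
proof -
  interpret graph G by fact
  have "inj_on (head G) (out_arcs G a)"
    using no_multi_arcs by (auto simp: inj_on_def arc_to_ends_def)
  moreover have "head G ` out_arcs G a = arcs_ends G `` {a}"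
    by (auto simp: arcs_ends_conv)
  ultimately show ?thesis
    unfolding out_degree_def by (metis card_image)
qed

text \<open>The Schur basis, orthonormalized, has the eigenvalues as Rayleigh quotients, and these
  are energies. Any bound valid for all orthonormal families thus bounds
  \<open>laplacian_sum\<close>.\<close>

lemma laplacian_sum_eq_sum_energy:
  assumes "graph G" "k \<le> card (verts G)"
  shows "\<exists>v. orthonormal_on (verts G) k v \<and> laplacian_sum G k = (\<Sum>j<k. energy (arcs_ends G) (v j))"
proof -
  interpret graph G by fact
  note R = graph_arcs_ends[OF \<open>graph G\<close>]
  define n where "n = card (verts G)"
  define vs where "vs = vertex_list G"
  have vs: "distinct vs" "set vs = verts G"
    using someI_ex[of "\<lambda>vs. distinct vs \<and> set vs = verts G"] finite_distinct_list[OF finite_verts]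
    by (auto simp: vs_def vertex_list_def)
  then have len: "length vs = n"
    using distinct_card[of vs] by (simp add: n_def)
  have bij: "bij_betw ((!) vs) {..<n} (verts G)"
    using bij_betw_nth[OF vs(1)] vs(2) len by simp
  define L where "L = laplacian_matrix G"
  have L: "L \<in> carrier_mat n n"
    by (intro carrier_matI)
      (simp_all add: L_def laplacian_matrix_def degree_matrix_def adjacency_matrix_def n_def)
  have L_nth: "L $$ (i, j) = (if vs ! i = vs ! j then real (card (arcs_ends G `` {vs ! i})) else 0)
      - (if (vs ! i, vs ! j) \<in> arcs_ends G then 1 else 0)" if "i < n" "j < n" for i j
    using that vs(1) len
    by (simp add: L_def laplacian_matrix_def degree_matrix_def adjacency_matrix_def n_def[symmetric]
        vs_def[symmetric] nth_eq_iff_index_eq out_degree_eq_card_Image[OF \<open>graph G\<close>])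
  have "transpose_mat L = L"
    using L R(3) by (intro eq_matI) (auto simp: L_nth sym_def)
  then obtain es where es: "char_poly L = (\<Prod>e\<leftarrow>es. [:- e, 1:])" "length es = n"
    using real_symmetric_char_poly_splits[OF L] by blast
  define ev where "ev = laplacian_eigenvalues G"
  have "proots (\<Prod>e\<leftarrow>es. [:- e, 1:]) = mset es" for es :: "real list"
  proof (induction es)
    case (Cons e es)
    have "(\<Prod>e\<leftarrow>es. [:- e, 1:]) \<noteq> 0"
      by (auto simp: prod_list_zero_iff)
    then have "proots ([:- e, 1:] * (\<Prod>e\<leftarrow>es. [:- e, 1:])) = add_mset e (mset es)"
      by (subst proots_mult) (simp_all add: Cons.IH)
    then show ?case
      by simp
  qed simp
  then have "mset ev = mset es"
    by (simp add: ev_def laplacian_eigenvalues_def L_def[symmetric] es)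
  \<comment> \<open>The Schur diagonal follows the order of the given factorization; taking the
    sorted list puts the largest eigenvalues first.\<close>
  then have "char_poly L = (\<Prod>e\<leftarrow>ev. [:- e, 1:])"
    unfolding es(1) by (simp flip: prod_mset_prod_list)
  from schur_orthonormal_diagonal[OF L this] obtain u where
    on: "orthonormal_on {..<n} n u"
    and ev: "\<And>k. k < n \<Longrightarrow> ev ! k = (\<Sum>a<n. u k a * (\<Sum>b<n. L $$ (a, b) * u k b))"
    by blast
  \<comment> \<open>Transport from matrix indices to vertices along the inverse of the vertex
    list.\<close>
  define v where "v j x = u j (the_inv_into {..<n} ((!) vs) x)" for j x
  have v_nth: "v j (vs ! i) = u j i" if "i < n" for i j
    using bij that by (simp add: v_def the_inv_into_f_f bij_betw_def)
  have "(\<Sum>a\<in>verts G. v i a * v j a) = (\<Sum>a<n. u i a * u j a)" for i j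
    by (subst sum.reindex_bij_betw[OF bij, symmetric]) (simp add: v_nth)
  then have on': "orthonormal_on (verts G) k v"
    using on assms(2) by (simp add: orthonormal_on_def n_def)
  have energy: "ev ! j = energy (arcs_ends G) (v j)" if "j < n" for j
    unfolding ev[OF that] energy_eq_quadratic_form[OF finite_verts R(2,3)]
    by (simp add: sum.reindex_bij_betw[OF bij, symmetric] v_nth L_nth)
  have "laplacian_sum G k = (\<Sum>j<k. ev ! j)"
    unfolding laplacian_sum_def ev_def
    by (rule sum.reindex_bij_witness[of _ Suc "\<lambda>i. i - 1"]) auto
  also have "\<dots> = (\<Sum>j<k. energy (arcs_ends G) (v j))"
    using energy assms(2) by (simp add: n_def)
  finally show ?thesis
    using on' by blast
qed

section \<open>Deleting edges, and counting edges by components\<close>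

lemma graph_delete_edges:
  assumes "graph G" "graph K" "subgraph K G"
  shows "graph (delete_edges G K)" "arcs_ends (delete_edges G K) = arcs_ends G - arcs_ends K"
proof -
  interpret G: graph G by fact
  interpret K: graph K by fact
  have KG: "arcs K \<subseteq> arcs G" "tail K = tail G" "head K = head G"
    using assms(3) by (auto simp: subgraph_def compatible_def)
  show ends: "arcs_ends (delete_edges G K) = arcs_ends G - arcs_ends K"
  proof -
    \<comment> \<open>Without parallel arcs, no remaining arc can restore a deleted pair of
      ends.\<close>
    have "inj_on (arc_to_ends G) (arcs G)"
      using G.no_multi_arcs by (auto simp: inj_on_def)
    then have "arc_to_ends G ` (arcs G - arcs K) = arc_to_ends G ` arcs G - arc_to_ends G ` arcs K"
      using KG by (intro inj_on_image_set_diff) auto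
    moreover have "arc_to_ends (delete_edges G K) = arc_to_ends G" "arc_to_ends K = arc_to_ends G"
      using KG by (simp_all add: fun_eq_iff arc_to_ends_def delete_edges_def)
    ultimately show ?thesis
      by (simp add: arcs_ends_def delete_edges_def)
  qed
  have "sym (arcs_ends G - arcs_ends K)"
    using graph_arcs_ends(3)[OF assms(1)] graph_arcs_ends(3)[OF assms(2)] by (auto simp: sym_def)
  then have "symmetric (delete_edges G K)"
    by (simp add: symmetric_def ends)
  then show "graph (delete_edges G K)"
    using G.no_loops G.no_multi_arcs
    by unfold_locales (auto simp: delete_edges_def arc_to_ends_def)
qed

text \<open>Every edge lies in a non-trivial component, and these components are disjoint and
  consist of non-isolated vertices; sum their edge counts. The additive form avoids truncated
  subtraction.\<close>

lemma num_edges_cyclic_components_le: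
  assumes "graph H" and "\<forall>C \<in> nontrivial_components H. cyclic_graph c C"
  shows "num_edges H + card (nontrivial_components H)
    \<le> card (Domain (arcs_ends H)) + card (nontrivial_components H) * c"
proof -
  interpret graph H by fact
  let ?N = "nontrivial_components H"
  have sub: "?N \<subseteq> sccs"
    by (auto simp: nontrivial_components_def)
  have "finite sccs"
    by (simp add: sccs_conv_sccs_verts finite_sccs_verts)
  then have finN: "finite ?N"
    using sub finite_subset by blast
  have graphC: "graph C" if "C \<in> ?N" for C
    using assms(2) that by (auto simp: cyclic_graph_def)
  have finC: "finite (verts C)" if "C \<in> ?N" for C
    using graphC[OF that] by (meson fin_digraph.finite_verts graph_def digraph_def)
  have cover: "arcs_ends H \<subseteq> (\<Union>C\<in>?N. arcs_ends C)"
  proof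
    fix p assume "p \<in> arcs_ends H"
    then obtain e where e: "e \<in> arcs H" "p = (tail H e, head H e)"
      by (auto simp: arcs_ends_conv)
    define C where "C = H \<restriction> scc_of (tail H e)"
    have "C \<in> sccs"
      unfolding C_def using e by (intro in_verts_sccsD_sccs scc_of_in_sccs_verts) simp
    have verts: "verts C = scc_of (tail H e)"
      by (simp add: C_def)
    have "(tail H e, head H e) \<in> arcs_ends H"
      using e by (auto simp: arcs_ends_conv)
    then have "tail H e \<rightarrow>\<^sup>*\<^bsub>H\<^esub> head H e"
      by (rule reachable_adjI)
    then have ends: "tail H e \<in> scc_of (tail H e)" "head H e \<in> scc_of (tail H e)"
      using e by (auto intro: in_scc_of_self scc_ofI_reachable')
    \<comment> \<open>The ends are distinct, as there are no loops, so the component of the arc is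
      non-trivial.\<close>
    have "card {tail H e, head H e} \<le> card (verts C)"
      using ends sccs_verts_subsets[OF scc_of_in_sccs_verts[of "tail H e"]] e finite_verts
      by (intro card_mono) (auto simp: verts intro: finite_subset)
    then have "C \<in> ?N"
      using \<open>C \<in> sccs\<close> no_loops[OF e(1)] by (simp add: nontrivial_components_def)
    moreover have "p \<in> arcs_ends C"
      using e ends by (auto simp: C_def arcs_ends_conv)
    ultimately show "p \<in> (\<Union>C\<in>?N. arcs_ends C)"
      by blast
  qed
  have "card (arcs_ends H) \<le> card (\<Union>C\<in>?N. arcs_ends C)"
    using cover finN graph_arcs_ends(1)[OF graphC] by (intro card_mono) auto
  also have "\<dots> \<le> (\<Sum>C\<in>?N. card (arcs_ends C))"
    by (rule card_UN_le[OF finN])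
  also have "\<dots> = (\<Sum>C\<in>?N. 2 * num_edges C)"
    using card_arcs_ends[OF graphC] by simp
  finally have edges: "num_edges H \<le> (\<Sum>C\<in>?N. num_edges C)"
    using card_arcs_ends[OF \<open>graph H\<close>] by (simp flip: sum_distrib_left)
  have "(\<Sum>C\<in>?N. card (verts C)) = card (\<Union>C\<in>?N. verts C)"
    using finN finC sub by (intro card_UN_disjoint[symmetric] ballI impI scc_disj) auto
  also have "\<dots> \<le> card (Domain (arcs_ends H))"
  proof (rule card_mono)
    show "finite (Domain (arcs_ends H))"
      using graph_arcs_ends(1)[OF \<open>graph H\<close>] by (rule finite_Domain)
    show "(\<Union>C\<in>?N. verts C) \<subseteq> Domain (arcs_ends H)"
    proof
      fix x assume "x \<in> (\<Union>C\<in>?N. verts C)"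
      then obtain C where C: "C \<in> ?N" "x \<in> verts C"
        by blast
      then have "card (verts C) \<ge> 2" "C \<in> sccs"
        by (auto simp: nontrivial_components_def)
      have "verts C \<noteq> {x}"
        using \<open>card (verts C) \<ge> 2\<close> by auto
      then obtain y where y: "y \<in> verts C" "y \<noteq> x"
        using C by blast
      have "verts C \<in> sccs_verts"
        using \<open>C \<in> sccs\<close> by (simp add: sccs_verts_conv)
      then have "x \<rightarrow>\<^sup>*\<^bsub>H\<^esub> y"
        using C y by (simp add: in_sccs_verts_conv_reachable)
      \<comment> \<open>As \<open>y\<close> differs from \<open>x\<close>, the walk has a first arc,
        and it leaves \<open>x\<close>.\<close>
      then have "(x, y) \<in> (arcs_ends H)\<^sup>*"
        by (simp add: reachable_def rtrancl_on_rtranclI)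
      then show "x \<in> Domain (arcs_ends H)"
        using y by (metis Domain.intros converse_rtranclE)
    qed
  qed
  finally have verts: "(\<Sum>C\<in>?N. card (verts C)) \<le> card (Domain (arcs_ends H))" .
  have "(\<Sum>C\<in>?N. num_edges C + 1) = (\<Sum>C\<in>?N. card (verts C) + c)"
    using assms(2) by (intro sum.cong) (auto simp: cyclic_graph_def)
  then have "(\<Sum>C\<in>?N. num_edges C) + card ?N = (\<Sum>C\<in>?N. card (verts C)) + card ?N * c"
    by (simp only: sum.distrib sum_constant) simp
  then show ?thesis
    using edges verts by linarith
qed

section \<open>Brouwer's inequality\<close>

text \<open>After the component count, one copy of \<open>num_edges H\<close> remains and cancels
  against \<open>num_edges G\<close>, which exceeds it by the square of \<open>s\<close>. Twice the
  remaining difference is the quadratic in \<open>quad\<close>.\<close>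

lemma brouwer_holds_if_quadratic_nonneg:
  assumes "graph G" "subgraph K G" "complete_bipartite_digraph s s K"
    and H: "H = delete_edges G K"
    and r: "card (nontrivial_components H) = r"
    and cyclic: "\<forall>C \<in> nontrivial_components H. cyclic_graph c C"
    and k: "k \<le> card (verts G)"
    and quad: "0 \<le> (real k)\<^sup>2 - (2 * real s + 3) * real k
      + 2 * (real s)\<^sup>2 - 2 * real s - 2 * real r * (real c - 1)"
  shows "brouwer_holds G k"
proof -
  have "graph K"
    using assms(3) by (simp add: complete_bipartite_digraph_def)
  obtain U W where UW: "verts K = U \<union> W" "U \<inter> W = {}" "card U = s" "card W = s"
    and K_ends: "arcs_ends K = U \<times> W \<union> W \<times> U"
    using assms(3) by (auto simp: complete_bipartite_digraph_def)
  have subV: "U \<subseteq> verts G" "W \<subseteq> verts G"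
    using assms(2) UW by (auto simp: subgraph_def)
  have finV: "finite (verts G)"
    using \<open>graph G\<close> by (meson fin_digraph.finite_verts graph_def digraph_def)
  note fH = graph_delete_edges[OF \<open>graph G\<close> \<open>graph K\<close> assms(2), folded H]
  note RG = graph_arcs_ends[OF \<open>graph G\<close>] and RK = graph_arcs_ends[OF \<open>graph K\<close>]
    and RH = graph_arcs_ends[OF fH(1)]
  have "arcs_ends K \<subseteq> arcs_ends G"
    using assms(2) by (auto simp: subgraph_def compatible_def arcs_ends_conv)
  then have G_split: "arcs_ends G = arcs_ends H \<union> arcs_ends K" "arcs_ends H \<inter> arcs_ends K = {}"
    by (auto simp: fH(2))
  have HV: "arcs_ends H \<subseteq> verts G \<times> verts G"
    using RG(2) by (auto simp: fH(2))
  have "card (arcs_ends K) = 2 * s\<^sup>2"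
  proof -
    have "finite U" "finite W"
      using subV finV finite_subset by auto
    then show ?thesis
      using UW unfolding K_ends by (subst card_Un_disjoint) (auto simp: card_cartesian_product power2_eq_square)
  qed
  then have "2 * num_edges G = 2 * num_edges H + 2 * s\<^sup>2"
    using card_Un_disjoint[OF RH(1) RK(1) G_split(2)] card_arcs_ends[OF \<open>graph G\<close>] card_arcs_ends[OF fH(1)]
    by (simp add: G_split(1))
  then have "real (2 * num_edges G) = real (2 * num_edges H + 2 * s\<^sup>2)"
    by (rule arg_cong)
  then have edges: "real (num_edges G) = real (num_edges H) + (real s)\<^sup>2"
    by simp
  have "real (num_edges H + r) \<le> real (card (Domain (arcs_ends H)) + r * c)"
    using num_edges_cyclic_components_le[OF fH(1) cyclic] unfolding r of_nat_le_iff .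
  \<comment> \<open>Subtraction moves to the reals, since \<open>c - 1\<close> is -1 for
    trees.\<close>
  then have dom: "real (num_edges H) - real (card (Domain (arcs_ends H))) \<le> real r * (real c - 1)"
    by (simp add: algebra_simps)
  obtain v where on: "orthonormal_on (verts G) k v"
    and sum: "laplacian_sum G k = (\<Sum>j<k. energy (arcs_ends G) (v j))"
    using laplacian_sum_eq_sum_energy[OF \<open>graph G\<close> k] by blast
  have "laplacian_sum G k = (\<Sum>j<k. energy (arcs_ends H) (v j)) + (\<Sum>j<k. energy (arcs_ends K) (v j))"
    unfolding sum G_split(1) using energy_Un_disjoint[OF RH(1) RK(1) G_split(2)] by (simp add: sum.distrib)
  also have "\<dots> \<le> (2 * real k + real (card (arcs_ends H)) - real (card (Domain (arcs_ends H))))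
      + real s * (real k + 1)"
    unfolding K_ends
    by (intro add_mono sum_energy_le[OF on finV HV RH(4) RH(3)]
        sum_energy_complete_bipartite_le[OF on finV subV UW(2-4)])
  also have "\<dots> = 2 * real k + 2 * real (num_edges H) - real (card (Domain (arcs_ends H)))
      + real s * (real k + 1)"
    by (simp add: card_arcs_ends[OF fH(1)])
  also have "\<dots> \<le> 2 * real k + real (num_edges H) + real r * (real c - 1) + real s * (real k + 1)"
    using dom by linarith
  also have "\<dots> \<le> real (num_edges G) + real k * (real k + 1) / 2"
    using quad by (simp add: edges power2_eq_square field_simps)
  finally show ?thesis
    by (simp add: brouwer_holds_def)
qed

theorem theorem2p6:
  fixes G K H :: "('a, 'b) pre_digraph"
    and n s r p c :: nat
    and x1 y1 :: real
  assumes "graph G" and "Digraph_Component.connected G"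
    and "card (verts G) = n" and "n \<ge> 4"
    and "s \<ge> 2" and "complete_bipartite_digraph s s K"
    and "pre_digraph.max_subgraph G complete_bipartite K"
    and "H = delete_edges G K"
    and "card (nontrivial_components H) = r"
    and "\<forall>C \<in> nontrivial_components H. cyclic_graph c C"
    and "card (trivial_components H) = p"
    and "x1 = (2 * real s + 3
           + sqrt (20 * real s - 4 * (real s)^2 + 8 * real r * (real c - 1) + 9)) / 2"
    and "y1 = (2 * real s + 3
           - sqrt (20 * real s - 4 * (real s)^2 + 8 * real r * (real c - 1) + 9)) / 2"
  shows "(real s \<ge> (5 + sqrt (8 * real r * (real c - 1) + 34)) / 2 \<longrightarrow>
            (\<forall>k \<in> {1..n}. brouwer_holds G k)) \<and>
         (real s < (5 + sqrt (8 * real r * (real c - 1) + 34)) / 2 \<longrightarrow>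
            (\<forall>k::nat. x1 \<le> real k \<and> k \<le> n \<longrightarrow> brouwer_holds G k) \<and>
            (\<forall>k::nat. 1 \<le> k \<and> real k \<le> y1 \<longrightarrow> brouwer_holds G k))"
proof -
  define W where "W = 8 * real r * (real c - 1) + 34"
  define D where "D = 20 * real s - 4 * (real s)^2 + 8 * real r * (real c - 1) + 9"
  \<comment> \<open>The threshold on \<open>s\<close> compares \<open>2 * s - 5\<close> with
    \<open>sqrt W\<close>, so it governs the sign of \<open>D\<close>.\<close>
  have D_W: "D = W - (2 * real s - 5)\<^sup>2"
    by (simp add: D_def W_def power2_eq_square algebra_simps)
  have x1: "x1 = (2 * real s + 3 + sqrt D) / 2" and y1: "y1 = (2 * real s + 3 - sqrt D) / 2"
    using assms(12,13) by (simp_all add: D_def)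
  have KG: "subgraph K G"
    using assms(7) by (simp add: pre_digraph.max_subgraph_def)
  \<comment> \<open>Completing the square: four times the quadratic is the right-hand side minus
    \<open>D\<close>.\<close>
  have holds: "brouwer_holds G k" if "D \<le> (2 * real k - (2 * real s + 3))\<^sup>2" "k \<le> n" for k
  proof (rule brouwer_holds_if_quadratic_nonneg[OF assms(1) KG assms(6,8,9,10)])
    show "0 \<le> (real k)\<^sup>2 - (2 * real s + 3) * real k
      + 2 * (real s)\<^sup>2 - 2 * real s - 2 * real r * (real c - 1)"
      using that(1) by (simp add: D_def power2_eq_square algebra_simps)
  qed (use that assms(3) in simp)
  have first: "brouwer_holds G k" if "(5 + sqrt W) / 2 \<le> real s" "k \<le> n" for k
  proof -
    have "D \<le> 0"
    proof (cases "W \<ge> 0")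
      case True
      have "sqrt W \<le> 2 * real s - 5"
        using that by simp
      then have "(sqrt W)\<^sup>2 \<le> (2 * real s - 5)\<^sup>2"
        using True by (intro power_mono) auto
      then show ?thesis
        using True by (simp add: D_W)
    next
      \<comment> \<open>A negative \<open>W\<close> makes \<open>D\<close> negative at once,
        whatever the value of \<open>sqrt W\<close>.\<close>
      case False
      then show ?thesis
        using zero_le_power2[of "2 * real s - 5"] unfolding D_W by linarith
    qed
    then show ?thesis
      using that by (intro holds order_trans[OF _ zero_le_power2])
  qed
  have D_nonneg: "D \<ge> 0" if "real s < (5 + sqrt W) / 2"
  proof -
    define w where "w = 8 * (int r * (int c - 1)) + 34"
    have w: "W = real_of_int w"
      by (simp add: w_def W_def)
    \<comment> \<open>\<open>W\<close> may be negative (trees, \<open>r\<close> large), and \<open>sqrt\<close> is odd; but \<open>W\<close> is an integer congruent to 2 modulo 8.\<close>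
    have "w \<ge> 2"
    proof (rule ccontr)
      assume "\<not> w \<ge> 2"
      then have "w \<le> -6"
        unfolding w_def by presburger
      \<comment> \<open>As \<open>sqrt (-1) = -1\<close>, the threshold would be at most 2, against
        \<open>s \<ge> 2\<close>.\<close>
      then have "sqrt W \<le> sqrt (-1)"
        unfolding w by (intro real_sqrt_le_mono) simp
      then have "sqrt W \<le> -1"
        by (simp add: real_sqrt_minus)
      then show False
        using that \<open>s \<ge> 2\<close> by simp
    qed
    then have "W \<ge> 2"
      by (simp add: w)
    have "(2 * real s - 5)\<^sup>2 \<le> W"
    \<comment> \<open>For \<open>s = 2\<close> the base \<open>2 * s - 5\<close> is -1 and squaring
      is not monotone there; its square 1 is below \<open>W \<ge> 2\<close>.\<close>
    proof (cases "s = 2")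
      case True
      then show ?thesis
        using \<open>W \<ge> 2\<close> by simp
    next
      case False
      then have "2 * real s - 5 \<ge> 0"
        using \<open>s \<ge> 2\<close> by simp
      then have "(2 * real s - 5)\<^sup>2 \<le> (sqrt W)\<^sup>2"
        using that by (intro power_mono) auto
      then show ?thesis
        using \<open>W \<ge> 2\<close> by simp
    qed
    then show ?thesis
      by (simp add: D_W)
  qed
  have upper: "brouwer_holds G k" if "real s < (5 + sqrt W) / 2" "x1 \<le> real k" "k \<le> n" for k
  proof (rule holds[OF _ that(3)])
    have "sqrt D \<le> 2 * real k - (2 * real s + 3)"
      using that by (simp add: x1)
    then have "(sqrt D)\<^sup>2 \<le> (2 * real k - (2 * real s + 3))\<^sup>2"
      using D_nonneg[OF that(1)] by (intro power_mono) auto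
    then show "D \<le> (2 * real k - (2 * real s + 3))\<^sup>2"
      using D_nonneg[OF that(1)] by simp
  qed
  have lower: "brouwer_holds G k" if "real s < (5 + sqrt W) / 2" "real k \<le> y1" for k
  proof (rule holds)
    have sqrt_D: "sqrt D \<le> (2 * real s + 3) - 2 * real k" "sqrt D \<ge> 0"
      using that D_nonneg[OF that(1)] by (simp_all add: y1)
    then have "(sqrt D)\<^sup>2 \<le> ((2 * real s + 3) - 2 * real k)\<^sup>2"
      by (intro power_mono) auto
    then show "D \<le> (2 * real k - (2 * real s + 3))\<^sup>2"
      using D_nonneg[OF that(1)] by (simp add: power2_commute)
    \<comment> \<open>\<open>k \<le> n\<close> is not assumed in this range: it follows from
      \<open>k \<le> 2 * s\<close>, the number of vertices of \<open>K\<close>.\<close>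
    have "2 * real k \<le> 2 * real s + 3"
      using sqrt_D by linarith
    then have "k \<le> 2 * s"
      using \<open>s \<ge> 2\<close> by linarith
    also have "2 * s \<le> n"
    proof -
      obtain U V where UV: "verts K = U \<union> V" "U \<inter> V = {}" "card U = s" "card V = s"
        using assms(6) by (auto simp: complete_bipartite_digraph_def)
      have "finite (verts G)"
        using \<open>graph G\<close> by (meson fin_digraph.finite_verts graph_def digraph_def)
      moreover have "verts K \<subseteq> verts G"
        using KG by (simp add: subgraph_def)
      ultimately have "card (U \<union> V) \<le> n" "finite U" "finite V"
        using UV assms(3) by (auto intro: card_mono finite_subset)
      then show ?thesis
        using UV by (simp add: card_Un_disjoint)
    qed
    finally show "k \<le> n" .
  qed
  show ?thesis
    using first upper lower unfolding W_def by auto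
qed

end
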